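(* Consider the Generalized Multiple Strip Packing Problem (GMSPP). For each of the two objectives (total area $\sum_{i\in\mathcal I}W_iH_i$ and makespan $\max_{i\in\mathcal I}H_i$), and for every instance, the optimal value of the linear program LP-PC is at least the optimal value of the LP relaxation of the big-$M$ formulation. Moreover, the dominance is strict on some instances.
   Context: **Instance.** Items $\mathcal J=\{1,\dots,n\}$, strips $\mathcal I=\{1,\dots,m\}$; strip $i$ has positive integer width $W_i$ and infinite height. Item $j$, if assigned to strip $i$, is a rectangle of positive integer width $w_{ij}$ and positive integer height $h_{ij}$. Item $j$ may be packed in strip $i$ only if $w_{ij}\le W_i$ (then the pair $(i,j)$ is called eligible); every item is eligible for at least one strip. In the GMSPP each item is packed exactly once in some strip, without overlap, without rotation, with edges parallel to the strip borders; $H_i\ge 0$ denotes the height of strip $i$. The objective is to minimize either $\sum_i W_iH_i$ (total area) or $\max_i H_i$ (makespan). In the models below the makespan objective is written as $\min H^{\max}$ with $H^{\max}\ge H_i$ for all $i$. **Normal positions.** For an eligible pair $(i,j)$, $\mathcal W_i(j)$ is the set of $p\in\{0,\dots,W_i-w_{ij}\}$ that can be written as $\sum_{k\in S}w_{ik}$ for some subset $S\subseteq\mathcal J\setminus\{j\}$ (the empty sum $0$ is allowed); for non-eligible pairs $\mathcal W_i(j)=\emptyset$. For $q\in\{0,\dots,W_i-1\}$, $\mathcal W_i(j,q)=\{p\in\mathcal W_i(j): p\le q\le p+w_{ij}-1\}$ is the subset of positions at which item $j$ covers column $q$. **LP-PC.** LP-PC is the linear program with variables $0\le x_{ijp}\le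 1$ ($i\in\mathcal I$, $j\in\mathcal J$, $p\in\mathcal W_i(j)$) and $H_i\ge 0$, minimizing the chosen objective subject to - $\sum_{i}\sum_{p\in\mathcal W_i(j)}x_{ijp}=1$ for all $j\in\mathcal J$; - $\sum_{j}\sum_{p\in\mathcal W_i(j,q)}h_{ij}x_{ijp}\le H_i$ for all $i\in\mathcal I$, $q\in\{0,\dots,W_i-1\}$ (column loads); - $h_{ij}\sum_{p\in\mathcal W_i(j)}x_{ijp}\le H_i$ for all $i\in\mathcal I$, $j\in\mathcal J$ (height linking). **Big-$M$ formulation.** Let $M_i=\sum_{j:\,w_{ij}\le W_i}h_{ij}$. The variables are: $z_{ij}\in\{0,1\}$, $x_{ij}\ge 0$, $y_{ij}\ge 0$ for eligible pairs $(i,j)$; $\ell_{jk},b_{jk}\in\{0,1\}$ for ordered pairs $j\neq k$ of items; and $H_i\ge0$. Minimize the chosen objective subject to - $\sum_{i:\,w_{ij}\le W_i}z_{ij}=1$ for all $j$; - $x_{ij}+w_{ij}\le W_i$ for all eligible $(i,j)$; - $y_{ij}+h_{ij}\le H_i+h_{ij}(1-z_{ij})$ for all eligible $(i,j)$; - $x_{ij}\le (W_i-w_{ij})z_{ij}$ and $y_{ij}\le (M_i-h_{ij})z_{ij}$ for all eligible $(i,j)$; - $x_{ij}+w_{ij}\le x_{ik}+W_i(3-\ell_{jk}-z_{ij}-z_{ik})$ for all $i$ and all $j\ne k$ both eligible for $i$; - $y_{ij}+h_{ij}\le y_{ik}+M_i(3-b_{jk}-z_{ij}-z_{ik})$ for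 all $i$ and all $j\ne k$ both eligible for $i$; - $\ell_{jk}+\ell_{kj}+b_{jk}+b_{kj}=1$ for all $j<k$. Its LP relaxation replaces $z_{ij},\ell_{jk},b_{jk}\in\{0,1\}$ by $z_{ij},\ell_{jk},b_{jk}\in[0,1]$. *)

theory Defs
  imports "HOL-Library.Extended_Real"
begin

record gmspp =
  nitems :: nat
  nstrips :: nat
  strip_width :: "nat \<Rightarrow> nat"
  item_width :: "nat \<Rightarrow> nat \<Rightarrow> nat"
  item_height :: "nat \<Rightarrow> nat \<Rightarrow> nat"

text \<open>For the last two fields the strip is the first argument and the item the second.\<close>

definition items :: "gmspp \<Rightarrow> nat set" where
  "items G = {1..nitems G}"

definition strips :: "gmspp \<Rightarrow> nat set" where
  "strips G = {1..nstrips G}"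

definition eligible :: "gmspp \<Rightarrow> nat \<Rightarrow> nat \<Rightarrow> bool" where
  "eligible G i j \<longleftrightarrow> item_width G i j \<le> strip_width G i"

definition gmspp_instance :: "gmspp \<Rightarrow> bool" where
  "gmspp_instance G \<longleftrightarrow>
     nstrips G \<ge> 1 \<and>
     (\<forall>i\<in>strips G. strip_width G i > 0) \<and>
     (\<forall>i\<in>strips G. \<forall>j\<in>items G. item_width G i j > 0 \<and> item_height G i j > 0) \<and>
     (\<forall>j\<in>items G. \<exists>i\<in>strips G. eligible G i j)"

datatype objective = Total_Area | Makespan

text \<open>
  \<open>objective_value G ob H v\<close> says that the strip heights \<open>H\<close> admit the objective value \<open>v\<close>.
  For the makespan, \<open>v\<close> plays the role of the extra decision variable \<open>H\<^sup>m\<^sup>a\<^sup>x\<close>, which is only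
  constrained from below.
\<close>

fun objective_value :: "gmspp \<Rightarrow> objective \<Rightarrow> (nat \<Rightarrow> real) \<Rightarrow> real \<Rightarrow> bool" where
  "objective_value G Total_Area H v \<longleftrightarrow> v = (\<Sum>i\<in>strips G. real (strip_width G i) * H i)"
| "objective_value G Makespan H v \<longleftrightarrow> (\<forall>i\<in>strips G. H i \<le> v)"

definition normal_positions :: "gmspp \<Rightarrow> nat \<Rightarrow> nat \<Rightarrow> nat set" where
  "normal_positions G i j =
     (if eligible G i j
      then {p \<in> {0..strip_width G i - item_width G i j}.
              \<exists>S \<subseteq> items G - {j}. p = (\<Sum>k\<in>S. item_width G i k)}
      else {})"

definition covering_positions :: "gmspp \<Rightarrow> nat \<Rightarrow> nat \<Rightarrow> nat \<Rightarrow> nat set" where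
  "covering_positions G i j q =
     {p \<in> normal_positions G i j. p \<le> q \<and> q \<le> p + item_width G i j - 1}"

definition lp_pc_feasible ::
    "gmspp \<Rightarrow> (nat \<Rightarrow> nat \<Rightarrow> nat \<Rightarrow> real) \<Rightarrow> (nat \<Rightarrow> real) \<Rightarrow> bool" where
  "lp_pc_feasible G x H \<longleftrightarrow>
     (\<forall>i\<in>strips G. \<forall>j\<in>items G. \<forall>p\<in>normal_positions G i j. 0 \<le> x i j p \<and> x i j p \<le> 1) \<and>
     (\<forall>i\<in>strips G. 0 \<le> H i) \<and>
     (\<forall>j\<in>items G. (\<Sum>i\<in>strips G. \<Sum>p\<in>normal_positions G i j. x i j p) = 1) \<and>
     (\<forall>i\<in>strips G. \<forall>q\<in>{0..strip_width G i - 1}.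
        (\<Sum>j\<in>items G. \<Sum>p\<in>covering_positions G i j q. real (item_height G i j) * x i j p) \<le> H i) \<and>
     (\<forall>i\<in>strips G. \<forall>j\<in>items G.
        real (item_height G i j) * (\<Sum>p\<in>normal_positions G i j. x i j p) \<le> H i)"

definition big_M :: "gmspp \<Rightarrow> nat \<Rightarrow> real" where
  "big_M G i = (\<Sum>j\<in>{j \<in> items G. eligible G i j}. real (item_height G i j))"

text \<open>
  The set \<open>D\<close> is the domain of the binary variables \<open>z\<close>, \<open>l\<close>, \<open>b\<close>: \<open>D = {0, 1}\<close> gives the
  mixed-integer big-M formulation and \<open>D = {0..1}\<close> its LP relaxation.  The values of \<open>z\<close>, \<open>x\<close>,
  \<open>y\<close> at non-eligible pairs and of \<open>l\<close>, \<open>b\<close> on the diagonal are not variables of the model and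
  occur in no constraint.
\<close>

definition bigM_feasible ::
    "real set \<Rightarrow> gmspp \<Rightarrow> (nat \<Rightarrow> nat \<Rightarrow> real) \<Rightarrow> (nat \<Rightarrow> nat \<Rightarrow> real) \<Rightarrow> (nat \<Rightarrow> nat \<Rightarrow> real)
      \<Rightarrow> (nat \<Rightarrow> nat \<Rightarrow> real) \<Rightarrow> (nat \<Rightarrow> nat \<Rightarrow> real) \<Rightarrow> (nat \<Rightarrow> real) \<Rightarrow> bool" where
  "bigM_feasible D G z x y l b H \<longleftrightarrow>
     (\<forall>i\<in>strips G. \<forall>j\<in>items G. eligible G i j \<longrightarrow>
        z i j \<in> D \<and> 0 \<le> x i j \<and> 0 \<le> y i j) \<and>
     (\<forall>j\<in>items G. \<forall>k\<in>items G. j \<noteq> k \<longrightarrow> l j k \<in> D \<and> b j k \<in> D) \<and>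
     (\<forall>i\<in>strips G. 0 \<le> H i) \<and>
     (\<forall>j\<in>items G. (\<Sum>i\<in>{i \<in> strips G. eligible G i j}. z i j) = 1) \<and>
     (\<forall>i\<in>strips G. \<forall>j\<in>items G. eligible G i j \<longrightarrow>
        x i j + real (item_width G i j) \<le> real (strip_width G i) \<and>
        y i j + real (item_height G i j) \<le> H i + real (item_height G i j) * (1 - z i j) \<and>
        x i j \<le> (real (strip_width G i) - real (item_width G i j)) * z i j \<and>
        y i j \<le> (big_M G i - real (item_height G i j)) * z i j) \<and>
     (\<forall>i\<in>strips G. \<forall>j\<in>items G. \<forall>k\<in>items G.
        j \<noteq> k \<and> eligible G i j \<and> eligible G i k \<longrightarrow>
        x i j + real (item_width G i j)
          \<le> x i k + real (strip_width G i) * (3 - l j k - z i j - z i k) \<and>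
        y i j + real (item_height G i j)
          \<le> y i k + big_M G i * (3 - b j k - z i j - z i k)) \<and>
     (\<forall>j\<in>items G. \<forall>k\<in>items G. j < k \<longrightarrow> l j k + l k j + b j k + b k j = 1)"

text \<open>
  Optimal values are infima in the extended reals, so that an infeasible program would have
  value \<open>\<infinity>\<close>.
\<close>

definition lp_pc_opt :: "gmspp \<Rightarrow> objective \<Rightarrow> ereal" where
  "lp_pc_opt G ob = Inf {ereal v | v x H. lp_pc_feasible G x H \<and> objective_value G ob H v}"

definition bigM_lp_opt :: "gmspp \<Rightarrow> objective \<Rightarrow> ereal" where
  "bigM_lp_opt G ob =
     Inf {ereal v | v z x y l b H.
            bigM_feasible {0..1} G z x y l b H \<and> objective_value G ob H v}"

end

theory Submission
  imports Defs
begin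

text \<open>
  The big-M relaxation only sees a fractional assignment \<open>z\<close> and the bounds
  \<open>h\<^sub>i\<^sub>j z\<^sub>i\<^sub>j \<le> H\<^sub>i\<close>: with every item at the origin and \<open>l = 0\<close>, the non-overlap constraints can be met
  by a suitable \<open>b\<close>.  They bind for \<open>j\<close>, \<open>k\<close> only in a strip with \<open>z\<^sub>i\<^sub>j + z\<^sub>i\<^sub>k > 1\<close>, and there is at
  most one such strip because these sums add up to 2 over all strips.  In that strip
  \<open>b\<^sub>j\<^sub>k = h\<^sub>i\<^sub>k / (h\<^sub>i\<^sub>j + h\<^sub>i\<^sub>k)\<close> works since \<open>h\<^sub>i\<^sub>j + h\<^sub>i\<^sub>k \<le> M\<^sub>i\<close>.  The projection
  \<open>z\<^sub>i\<^sub>j = \<Sum>\<^sub>p x\<^sub>i\<^sub>j\<^sub>p\<close> of an LP-PC solution is such an assignment.  Strictness: two unit squares in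
  one strip of width 1 need height 2 in LP-PC, whereas height 1 suffices in the relaxation.
\<close>

lemma finite_items [simp]: "finite (items G)"
  by (simp add: items_def)

lemma finite_strips [simp]: "finite (strips G)"
  by (simp add: strips_def)

lemma item_height_le_big_M:
  assumes "j \<in> items G" "eligible G i j"
  shows "real (item_height G i j) \<le> big_M G i"
  unfolding big_M_def using assms by (intro member_le_sum) auto

lemma item_heights_le_big_M:
  assumes "j \<in> items G" "eligible G i j" "k \<in> items G" "eligible G i k" "j \<noteq> k"
  shows "real (item_height G i j) + real (item_height G i k) \<le> big_M G i"
proof -
  have "(\<Sum>a\<in>{j, k}. real (item_height G i a)) \<le> big_M G i"
    unfolding big_M_def using assms by (intro sum_mono2) auto
  with \<open>j \<noteq> k\<close> show ?thesis by simp
qed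

text \<open>Stated for an arbitrary assignment, so that it serves both the projected LP-PC solutions
  and the explicit strict example. Fixing \<open>z\<close> to 0 at non-eligible pairs lets sums run
  over all strips.\<close>

lemma bigM_feasible_of_assignment:
  assumes G: "gmspp_instance G"
    and z_nonneg: "\<And>i j. i \<in> strips G \<Longrightarrow> j \<in> items G \<Longrightarrow> 0 \<le> z i j"
    and z_elig: "\<And>i j. i \<in> strips G \<Longrightarrow> j \<in> items G \<Longrightarrow> \<not> eligible G i j \<Longrightarrow> z i j = 0"
    and z_sum: "\<And>j. j \<in> items G \<Longrightarrow> (\<Sum>i\<in>strips G. z i j) = 1"
    and H_nonneg: "\<And>i. i \<in> strips G \<Longrightarrow> 0 \<le> H i"
    and H_ge: "\<And>i j. i \<in> strips G \<Longrightarrow> j \<in> items G \<Longrightarrow> real (item_height G i j) * z i j \<le> H i"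
  shows "\<exists>b. bigM_feasible {0..1} G z (\<lambda>_ _. 0) (\<lambda>_ _. 0) (\<lambda>_ _. 0) b H"
proof -
  let ?h = "\<lambda>i j. real (item_height G i j)"
  \<comment> \<open>The strip in which the pair competes; by \<open>s_eq\<close> it is unique if it
    exists, and \<open>b\<close> consults it only then.\<close>
  define s where "s j k = (SOME i. i \<in> strips G \<and> z i j + z i k > 1)" for j k
  have s_commute: "s j k = s k j" for j k
    by (simp add: s_def add.commute)
  have z_le: "z i j \<le> 1" if "i \<in> strips G" "j \<in> items G" for i j
    using member_le_sum[of i "strips G" "\<lambda>i. z i j"] that z_nonneg z_sum by auto
  have s_eq: "s j k = i"
    if "j \<in> items G" "k \<in> items G" "i \<in> strips G" "z i j + z i k > 1" for i j k
    unfolding s_def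
  proof (rule some_equality)
    fix i' assume i': "i' \<in> strips G \<and> z i' j + z i' k > 1"
    show "i' = i"
    proof (rule ccontr)
      assume "i' \<noteq> i"
      have "(\<Sum>a\<in>{i, i'}. z a j + z a k) \<le> (\<Sum>a\<in>strips G. z a j + z a k)"
        using that i' z_nonneg by (intro sum_mono2) auto
      also have "\<dots> = 2"
        using z_sum that by (simp add: sum.distrib)
      finally show False using \<open>i' \<noteq> i\<close> that i' by simp
    qed
  qed (use that in auto)
  \<comment> \<open>With \<open>l = 0\<close>, \<open>b j k\<close> and \<open>b k j\<close> must
    add up to 1; pairs without a critical strip take the symmetric default 1/2.\<close>
  define b where
    "b j k = (if \<exists>i\<in>strips G. z i j + z i k > 1
              then ?h (s j k) k / (?h (s j k) j + ?h (s j k) k) else 1 / 2)" for j k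
  \<comment> \<open>This covers all indices, since a quotient with zero denominator is 0.\<close>
  have b_bounds: "0 \<le> b j k" "b j k \<le> 1" for j k
    by (auto simp: b_def divide_le_eq_1)
  have b_sum: "b j k + b k j = 1" if "j \<in> items G" "k \<in> items G" for j k
  proof (cases "\<exists>i\<in>strips G. z i j + z i k > 1")
    case True
    then obtain i where i: "i \<in> strips G" "z i j + z i k > 1" by blast
    have "?h i j > 0" using G i that by (simp add: gmspp_instance_def)
    then have "?h i k / (?h i j + ?h i k) + ?h i j / (?h i k + ?h i j) = 1"
      by (simp add: add_divide_distrib[symmetric] add.commute)
    moreover have "\<exists>i\<in>strips G. z i k + z i j > 1"
      using True by (simp add: add.commute)
    ultimately show ?thesis
      using True s_eq[OF that i] s_commute[of k j] by (simp add: b_def)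
  next
    case False
    then have "\<not> (\<exists>i\<in>strips G. z i k + z i j > 1)" by (simp add: add.commute)
    with False show ?thesis by (simp add: b_def)
  qed
  \<comment> \<open>Since \<open>l = 0\<close> and \<open>z\<close> is at most 1, the factor is at
    least 1, so eligibility suffices.\<close>
  have width: "real (item_width G i j) \<le> real (strip_width G i) * (3 - z i j - z i k)"
    if "i \<in> strips G" "j \<in> items G" "k \<in> items G" "eligible G i j" for i j k
  proof -
    have "real (item_width G i j) \<le> real (strip_width G i) * 1"
      using that by (simp add: eligible_def)
    also have "\<dots> \<le> real (strip_width G i) * (3 - z i j - z i k)"
      using z_le[of i j] z_le[of i k] that by (intro mult_left_mono) auto
    finally show ?thesis .
  qed
  \<comment> \<open>If \<open>z i j + z i k\<close> exceeds 1, only the bound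
    \<open>1 - b j k\<close> on the factor remains and the choice of \<open>b\<close> matters.
    Otherwise the factor is at least \<open>2 - b j k\<close>, hence at least 1.\<close>
  have height: "?h i j \<le> big_M G i * (3 - b j k - z i j - z i k)"
    if "i \<in> strips G" "j \<in> items G" "k \<in> items G" "j \<noteq> k" "eligible G i j" "eligible G i k"
    for i j k
  proof (cases "z i j + z i k > 1")
    case True
    have pos: "?h i j > 0" "?h i k > 0" using G that by (auto simp: gmspp_instance_def)
    have M: "?h i j + ?h i k \<le> big_M G i" using item_heights_le_big_M that by blast
    have "b j k = ?h i k / (?h i j + ?h i k)"
      using s_eq[of j k i] True that by (auto simp: b_def)
    then have b_eq: "1 - b j k = ?h i j / (?h i j + ?h i k)"
      using pos by (simp add: field_simps)
    have "?h i j = (?h i j + ?h i k) * (1 - b j k)"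
      using pos by (simp add: b_eq)
    also have "\<dots> \<le> big_M G i * (1 - b j k)"
      using M b_bounds by (intro mult_right_mono) auto
    also have "\<dots> \<le> big_M G i * (3 - b j k - z i j - z i k)"
      using z_le[of i j] z_le[of i k] that M pos by (intro mult_left_mono) auto
    finally show ?thesis .
  next
    case False
    have M: "?h i j \<le> big_M G i" using item_height_le_big_M that by blast
    also have "\<dots> = big_M G i * 1" by simp
    also have "\<dots> \<le> big_M G i * (3 - b j k - z i j - z i k)"
      using False b_bounds[where j=j and k=k] order_trans[OF _ M, of 0]
      by (intro mult_left_mono) auto
    finally show ?thesis .
  qed
  have z_sum_eligible: "(\<Sum>i\<in>{i \<in> strips G. eligible G i j}. z i j) = 1" if "j \<in> items G" for j
    using sum.mono_neutral_left[of "strips G" "{i \<in> strips G. eligible G i j}" "\<lambda>i. z i j"]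
      z_elig z_sum that by auto
  have linking: "?h i j \<le> H i + ?h i j * (1 - z i j)" if "i \<in> strips G" "j \<in> items G" for i j
    using H_ge[OF that] by (simp add: right_diff_distrib)
  \<comment> \<open>At the origin, the upper bounds on the coordinates only ask for nonnegative
    right-hand sides.\<close>
  have x_bound: "0 \<le> (real (strip_width G i) - real (item_width G i j)) * z i j"
    and y_bound: "0 \<le> (big_M G i - ?h i j) * z i j"
    if "i \<in> strips G" "j \<in> items G" "eligible G i j" for i j
    using that z_nonneg[of i j] item_height_le_big_M[of j G i] by (auto simp: eligible_def)
  have "bigM_feasible {0..1} G z (\<lambda>_ _. 0) (\<lambda>_ _. 0) (\<lambda>_ _. 0) b H"
    unfolding bigM_feasible_def add_0_left diff_0_right atLeastAtMost_iff
    by (intro conjI ballI impI; (elim conjE)?;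
        ((rule order_refl zero_le_one z_nonneg z_le b_bounds H_nonneg z_sum_eligible linking
            x_bound y_bound width height b_sum; assumption) | simp add: eligible_def))
  then show ?thesis by blast
qed

lemma normal_positions_not_eligible: "\<not> eligible G i j \<Longrightarrow> normal_positions G i j = {}"
  by (simp add: normal_positions_def)

lemma normal_positions_le:
  "p \<in> normal_positions G i j \<Longrightarrow> p \<le> strip_width G i - item_width G i j"
  by (simp add: normal_positions_def split: if_splits)

lemma zero_in_normal_positions:
  assumes "eligible G i j"
  shows "0 \<in> normal_positions G i j"
proof -
  have "\<exists>S\<subseteq>items G - {j}. 0 = (\<Sum>k\<in>S. item_width G i k)"
    by (rule exI[of _ "{}"]) simp
  with assms show ?thesis by (simp add: normal_positions_def)
qed

text \<open>Keeping \<open>H\<close> preserves both objectives. Height linking supplies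
  \<open>H_ge\<close> for the projection, and the empty position sets make it vanish at non-eligible
  pairs.\<close>

lemma bigM_feasible_of_lp_pc_feasible:
  assumes "gmspp_instance G" "lp_pc_feasible G x H"
  shows "\<exists>z b. bigM_feasible {0..1} G z (\<lambda>_ _. 0) (\<lambda>_ _. 0) (\<lambda>_ _. 0) b H"
proof -
  have "\<exists>b. bigM_feasible {0..1} G (\<lambda>i j. \<Sum>p\<in>normal_positions G i j. x i j p)
              (\<lambda>_ _. 0) (\<lambda>_ _. 0) (\<lambda>_ _. 0) b H"
    using assms
    by (intro bigM_feasible_of_assignment)
       (auto simp: lp_pc_feasible_def normal_positions_not_eligible intro!: sum_nonneg)
  then show ?thesis by blast
qed

lemma bigM_lp_opt_le:
  assumes "bigM_feasible {0..1} G z x y l b H" "objective_value G ob H v"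
  shows "bigM_lp_opt G ob \<le> ereal v"
  unfolding bigM_lp_opt_def
  by (intro Inf_lower CollectI exI conjI) (rule refl assms)+

lemma bigM_lp_opt_le_lp_pc_opt:
  assumes "gmspp_instance G"
  shows "bigM_lp_opt G ob \<le> lp_pc_opt G ob"
  unfolding lp_pc_opt_def
proof (rule Inf_greatest)
  fix u assume "u \<in> {ereal v | v x H. lp_pc_feasible G x H \<and> objective_value G ob H v}"
  then obtain v x H where u: "u = ereal v"
    and x: "lp_pc_feasible G x H" and v: "objective_value G ob H v"
    by blast
  obtain z b where "bigM_feasible {0..1} G z (\<lambda>_ _. 0) (\<lambda>_ _. 0) (\<lambda>_ _. 0) b H"
    using bigM_feasible_of_lp_pc_feasible[OF assms x] by blast
  with v show "bigM_lp_opt G ob \<le> u"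
    unfolding u by (rule bigM_lp_opt_le[rotated])
qed

definition two_squares :: gmspp where
  "two_squares = \<lparr>nitems = 2, nstrips = 1, strip_width = (\<lambda>_. 1),
                  item_width = (\<lambda>_ _. 1), item_height = (\<lambda>_ _. 1)\<rparr>"

lemma two_squares_simps:
  "items two_squares = {1, 2}" "strips two_squares = {1}"
  "strip_width two_squares i = 1" "item_width two_squares i j = 1"
  "item_height two_squares i j = 1" "eligible two_squares i j"
  by (auto simp: two_squares_def items_def strips_def eligible_def)

lemma gmspp_instance_two_squares: "gmspp_instance two_squares"
  by (simp add: gmspp_instance_def two_squares_simps) (simp add: two_squares_def)

lemma normal_positions_two_squares: "normal_positions two_squares i j = {0}"
  using zero_in_normal_positions[of two_squares i j] normal_positions_le[of _ two_squares i j]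
  by (auto simp: two_squares_simps)

lemma lp_pc_opt_two_squares: "2 \<le> lp_pc_opt two_squares ob"
  unfolding lp_pc_opt_def
proof (rule Inf_greatest)
  fix u
  assume "u \<in> {ereal v | v x H. lp_pc_feasible two_squares x H \<and> objective_value two_squares ob H v}"
  then obtain v x H where u: "u = ereal v" and feas: "lp_pc_feasible two_squares x H"
    and v: "objective_value two_squares ob H v"
    by blast
  have cover: "covering_positions two_squares i j 0 = {0}" for i j
    by (auto simp: covering_positions_def normal_positions_two_squares)
  \<comment> \<open>Each square has 0 as its only position, so the assignment equations put both
    fully on column 0, whose load is then 2.\<close>
  have "2 \<le> H 1"
    using feas by (simp add: lp_pc_feasible_def normal_positions_two_squares two_squares_simps cover)
  with v have "2 \<le> v"
    by (cases ob) (auto simp: two_squares_simps)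
  then show "2 \<le> u" by (simp add: u)
qed

lemma bigM_lp_opt_two_squares: "bigM_lp_opt two_squares ob \<le> 1"
proof -
  \<comment> \<open>Both squares are fully assigned to the only strip, so the condition on
    \<open>H\<close> reads 1 \<le> 1.\<close>
  obtain b where "bigM_feasible {0..1} two_squares (\<lambda>_ _. 1) (\<lambda>_ _. 0) (\<lambda>_ _. 0) (\<lambda>_ _. 0) b (\<lambda>_. 1)"
    using bigM_feasible_of_assignment[OF gmspp_instance_two_squares, of "\<lambda>_ _. 1" "\<lambda>_. 1"]
    by (auto simp: two_squares_simps)
  moreover have "objective_value two_squares ob (\<lambda>_. 1) 1"
    by (cases ob) (auto simp: two_squares_simps)
  ultimately have "bigM_lp_opt two_squares ob \<le> ereal 1"
    by (rule bigM_lp_opt_le)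
  then show ?thesis by (simp add: one_ereal_def)
qed

theorem proposition2:
  fixes ob :: objective
  shows "(\<forall>G. gmspp_instance G \<longrightarrow> lp_pc_opt G ob \<ge> bigM_lp_opt G ob) \<and>
         (\<exists>G. gmspp_instance G \<and> lp_pc_opt G ob > bigM_lp_opt G ob)"
proof -
  have "bigM_lp_opt two_squares ob \<le> 1" by (rule bigM_lp_opt_two_squares)
  also have "(1::ereal) < 2" by simp
  also have "2 \<le> lp_pc_opt two_squares ob" by (rule lp_pc_opt_two_squares)
  finally show ?thesis
    using bigM_lp_opt_le_lp_pc_opt gmspp_instance_two_squares by blast
qed

end
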